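(* Let $\mathcal{A}$ be a unital complex algebra, $\psi,\varphi:\mathcal{A}\to\mathbb{C}$ unital linear functionals, and let $\mathcal{A}_1,\mathcal{A}_2\subset\mathcal{A}$ be two unital subalgebras that are conditionally free with respect to $(\psi,\varphi)$. Then $\mathbb{C}\langle x_a:a\in\mathcal{A}_1\rangle$ and $\mathbb{C}\langle x_a:a\in\mathcal{A}_2\rangle$ are cyclically free unital subalgebras of $\mathbb{C}\langle x_a:a\in\mathcal{A}\rangle$ with respect to the pair $(\psi,W(\varphi))$.
   Context: $\mathbb{C}\langle x_a:a\in\mathcal{A}\rangle$ is the free unital complex algebra on non-commuting indeterminates $x_a$ indexed by $a\in\mathcal{A}$ (no linear relations are imposed between the $x_a$). The functional $\psi$ is extended to it by $\psi(x_{a_1}\cdots x_{a_n})=\psi(a_1\cdots a_n)$, $\psi(1)=1$. The tracial functional $W(\varphi)$ on it is defined by $W(\varphi)(1)=0$ and $$W(\varphi)(x_{a_1}\cdots x_{a_n})=\sum_{i=1}^n\beta^\varphi(a_i,a_{i+1},\ldots,a_n,a_1,\ldots,a_{i-1},a_i)$$ (each Boolean cumulant has $n+1$ arguments). Boolean cumulants $\beta^\varphi$ are defined recursively by $\varphi(a_1\cdots a_n)=\sum_{I}\prod_{\{i,\ldots,j\}\in I}\beta^\varphi(a_i,\ldots,a_j)$, the sum over interval partitions $I$ of $\{1,\ldots,n\}$. Conditional freeness of $\mathcal{A}_1,\mathcal{A}_2$ with respect to $(\psi,\varphi)$: for all $a_k\in\mathcal{A}_{j_k}$ with $j_k\ne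 j_{k+1}$ ($1\le k\le n-1$) and $\psi(a_k)=0$ for all $k$, $\psi(a_1\cdots a_n)=0$ and $\varphi(a_1\cdots a_n)=\varphi(a_1)\cdots\varphi(a_n)$. Cyclic freeness of unital subalgebras $\mathcal{B}_1,\mathcal{B}_2$ with respect to $(\psi,\omega)$, $\omega$ tracial: they are free with respect to $\psi$ and $\omega(b_1\cdots b_n)=0$ for all $n\ge2$ and $b_k\in\mathcal{B}_{j_k}$ with $\psi(b_k)=0$ for all $k$, $j_k\ne j_{k+1}$ for $1\le k\le n-1$, and $j_n\ne j_1$. *)

theory Defs
  imports Complex_Main "HOL-Library.Poly_Mapping" "HOL-Library.Disjoint_Sets"
begin

section \<open>Unital complex algebras\<close>

text \<open>A unital complex algebra is a type of class \<open>ring_1\<close> with an explicit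
  scalar multiplication.\<close>

locale complex_algebra = vector_space scale
  for scale :: "complex \<Rightarrow> 'a::ring_1 \<Rightarrow> 'a" +
  assumes scale_mult_left: "scale c (x * y) = scale c x * y"
    and scale_mult_right: "scale c (x * y) = x * scale c y"

definition unital_subalgebra :: "(complex \<Rightarrow> 'a::ring_1 \<Rightarrow> 'a) \<Rightarrow> 'a set \<Rightarrow> bool" where
  "unital_subalgebra scale B \<longleftrightarrow>
     module.subspace scale B \<and> 1 \<in> B \<and> (\<forall>x\<in>B. \<forall>y\<in>B. x * y \<in> B)"

definition linear_functional :: "(complex \<Rightarrow> 'a::ring_1 \<Rightarrow> 'a) \<Rightarrow> ('a \<Rightarrow> complex) \<Rightarrow> bool" where
  "linear_functional scale f \<longleftrightarrow> Vector_Spaces.linear scale (*) f"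

definition unital_functional :: "(complex \<Rightarrow> 'a::ring_1 \<Rightarrow> 'a) \<Rightarrow> ('a \<Rightarrow> complex) \<Rightarrow> bool" where
  "unital_functional scale f \<longleftrightarrow> linear_functional scale f \<and> f 1 = 1"

definition tracial_functional :: "(complex \<Rightarrow> 'a::ring_1 \<Rightarrow> 'a) \<Rightarrow> ('a \<Rightarrow> complex) \<Rightarrow> bool" where
  "tracial_functional scale f \<longleftrightarrow> linear_functional scale f \<and> (\<forall>x y. f (x * y) = f (y * x))"


section \<open>Free, conditionally free and cyclically free subalgebras\<close>

text \<open>The ordered product \<open>a\<^sub>1 \<cdots> a\<^sub>n\<close>; the factors need not commute.\<close>

definition oprod :: "nat \<Rightarrow> (nat \<Rightarrow> 'a::monoid_mult) \<Rightarrow> 'a" where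
  "oprod n a = prod_list (map a [1..<n + 1])"

text \<open>\<open>a\<^sub>k\<close> is a \<open>\<psi>\<close>-centred element of the subalgebra with index \<open>j\<^sub>k \<in> {1, 2}\<close>,
  for \<open>1 \<le> k \<le> n\<close>, and neighbouring indices are distinct.\<close>

definition alternating_centred ::
    "('a::ring_1 \<Rightarrow> complex) \<Rightarrow> 'a set \<Rightarrow> 'a set \<Rightarrow> nat \<Rightarrow> (nat \<Rightarrow> nat) \<Rightarrow> (nat \<Rightarrow> 'a) \<Rightarrow> bool" where
  "alternating_centred \<psi> A1 A2 n j a \<longleftrightarrow>
     (\<forall>k\<in>{1..n}. j k \<in> {1, 2} \<and> a k \<in> (if j k = 1 then A1 else A2) \<and> \<psi> (a k) = 0) \<and>
     (\<forall>k\<in>{1..<n}. j k \<noteq> j (k + 1))"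

definition free_wrt :: "('a::ring_1 \<Rightarrow> complex) \<Rightarrow> 'a set \<Rightarrow> 'a set \<Rightarrow> bool" where
  "free_wrt \<psi> A1 A2 \<longleftrightarrow>
     (\<forall>n\<ge>1. \<forall>j a. alternating_centred \<psi> A1 A2 n j a \<longrightarrow> \<psi> (oprod n a) = 0)"

definition conditionally_free ::
    "('a::ring_1 \<Rightarrow> complex) \<Rightarrow> ('a \<Rightarrow> complex) \<Rightarrow> 'a set \<Rightarrow> 'a set \<Rightarrow> bool" where
  "conditionally_free \<psi> \<phi> A1 A2 \<longleftrightarrow>
     (\<forall>n\<ge>1. \<forall>j a. alternating_centred \<psi> A1 A2 n j a \<longrightarrow>
        \<psi> (oprod n a) = 0 \<and> \<phi> (oprod n a) = (\<Prod>k = 1..n. \<phi> (a k)))"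

definition cyclically_free ::
    "('a::ring_1 \<Rightarrow> complex) \<Rightarrow> ('a \<Rightarrow> complex) \<Rightarrow> 'a set \<Rightarrow> 'a set \<Rightarrow> bool" where
  "cyclically_free \<psi> \<omega> B1 B2 \<longleftrightarrow>
     free_wrt \<psi> B1 B2 \<and>
     (\<forall>n\<ge>2. \<forall>j b. alternating_centred \<psi> B1 B2 n j b \<and> j n \<noteq> j 1 \<longrightarrow> \<omega> (oprod n b) = 0)"


section \<open>Boolean cumulants\<close>

definition interval_partitions :: "nat \<Rightarrow> nat set set set" where
  "interval_partitions n = {I. partition_on {..<n} I \<and> (\<forall>B\<in>I. \<exists>i j. B = {i..j})}"

lemma finite_interval_partitions: "finite (interval_partitions n)"
  by (rule finite_subset[of _ "Pow (Pow {..<n})"])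
     (auto simp: interval_partitions_def partition_on_def)

lemma interval_partition_block_less:
  assumes "I \<in> interval_partitions (length as) - {{{..<length as}}}" and "B \<in> I"
  shows "length (nths as B) < length as"
proof -
  have p: "partition_on {..<length as} I" and ne: "I \<noteq> {{..<length as}}"
    using assms(1) by (auto simp: interval_partitions_def)
  have sub: "B \<subseteq> {..<length as}"
    using p assms(2) by (auto simp: partition_on_def)
  have "B \<noteq> {..<length as}"
  proof
    assume B: "B = {..<length as}"
    have "C = B" if C: "C \<in> I" for C
    proof (rule ccontr)
      assume "C \<noteq> B"
      then have "C \<inter> B = {}"
        using p C assms(2) by (auto simp: partition_on_def disjoint_def)
      moreover have "C \<subseteq> B" "C \<noteq> {}"
        using p C B by (auto simp: partition_on_def)
      ultimately show False by blast
    qed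
    then show False using ne assms(2) B by blast
  qed
  with sub have "card B < card {..<length as}"
    by (intro psubset_card_mono) auto
  moreover have "{i. i < length as \<and> i \<in> B} = B"
    using sub by auto
  ultimately show ?thesis by (simp add: length_nths)
qed

text \<open>The moment-cumulant formula, solved for the summand of the one-block
  partition. Positions in a list are counted from \<open>0\<close>, and \<open>nths as {i..j}\<close> is the list
  of the entries in positions \<open>i\<close> to \<open>j\<close>.\<close>

function boolean_cumulant :: "('a::ring_1 \<Rightarrow> complex) \<Rightarrow> 'a list \<Rightarrow> complex" where
  "boolean_cumulant \<phi> as =
     \<phi> (prod_list as) -
     (\<Sum>I\<in>interval_partitions (length as) - {{{..<length as}}}.
        \<Prod>B\<in>I. boolean_cumulant \<phi> (nths as B))"
  by pat_completeness auto
termination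
  by (relation "measure (\<lambda>(\<phi>, as). length as)")
     (auto intro: interval_partition_block_less)

declare boolean_cumulant.simps [simp del]

lemma moment_boolean_cumulant:
  assumes "as \<noteq> []"
  shows "\<phi> (prod_list as) =
    (\<Sum>I\<in>interval_partitions (length as). \<Prod>B\<in>I. boolean_cumulant \<phi> (nths as B))"
proof -
  let ?n = "length as"
  have "{..<?n} = {0..?n - 1}"
    using assms by (cases as) auto
  then have "{{..<?n}} \<in> interval_partitions ?n"
    using assms by (auto simp: interval_partitions_def partition_on_def disjoint_def)
  then have "(\<Sum>I\<in>interval_partitions ?n. \<Prod>B\<in>I. boolean_cumulant \<phi> (nths as B)) =
    boolean_cumulant \<phi> as +
    (\<Sum>I\<in>interval_partitions ?n - {{{..<?n}}}. \<Prod>B\<in>I. boolean_cumulant \<phi> (nths as B))"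
    by (subst sum.remove[of _ "{{..<?n}}"]) (auto simp: finite_interval_partitions)
  then show ?thesis
    by (simp add: boolean_cumulant.simps[of \<phi> as])
qed


section \<open>The free algebra\<close>

text \<open>The free unital algebra on indeterminates indexed by a type \<open>'a\<close> is the monoid
  algebra of the free monoid of words. The ring structure of \<open>poly_mapping\<close> expects
  the monoid in additive notation, so concatenation of words is written \<open>+\<close>.\<close>

datatype 'a free_word = Word (letters: "'a list")

instantiation free_word :: (type) monoid_add
begin

definition zero_free_word :: "'a free_word" where
  "0 = Word []"

definition plus_free_word :: "'a free_word \<Rightarrow> 'a free_word \<Rightarrow> 'a free_word" where
  "v + w = Word (letters v @ letters w)"

instance
  by standard (auto simp: zero_free_word_def plus_free_word_def)

end

type_synonym 'a free_algebra = "'a free_word \<Rightarrow>\<^sub>0 complex"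

definition indet :: "'a \<Rightarrow> 'a free_algebra" where
  "indet a = Poly_Mapping.single (Word [a]) 1"

definition free_scale :: "complex \<Rightarrow> 'a free_algebra \<Rightarrow> 'a free_algebra" where
  "free_scale c p = Poly_Mapping.map ((*) c) p"

lemma lookup_free_scale [simp]:
  "Poly_Mapping.lookup (free_scale c p) w = c * Poly_Mapping.lookup p w"
  unfolding free_scale_def by transfer (simp add: when_def)

lemma free_scale_eq_mult: "free_scale c p = Poly_Mapping.single 0 c * p"
proof -
  have "Poly_Mapping.map ((*) c) p = Poly_Mapping.single 0 c * p"
    by (rule mult_map_scale_conv_mult)
  then show ?thesis by (simp add: free_scale_def)
qed

lemma complex_algebra_free_scale: "complex_algebra free_scale"
proof
  fix c :: complex and x y :: "'a free_algebra"
  show "free_scale c (x * y) = free_scale c x * y"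
    by (simp add: free_scale_eq_mult mult.assoc)
  have "Poly_Mapping.single 0 c * x = x * Poly_Mapping.single 0 c"
  proof (induction x rule: update_induct)
    case const
    show ?case by simp
  next
    case (update f w d)
    then have "Poly_Mapping.update w d f = Poly_Mapping.single w d + f"
      by (intro poly_mapping_eqI)
         (auto simp: lookup_update lookup_add lookup_single when_def in_keys_iff)
    then show ?case
      using update by (simp add: distrib_left distrib_right mult_single mult.commute)
  qed
  then show "free_scale c (x * y) = x * free_scale c y"
    by (simp add: free_scale_eq_mult flip: mult.assoc)
qed (auto intro!: poly_mapping_eqI simp: lookup_add algebra_simps)

text \<open>The free algebra on the indeterminates \<open>x\<^sub>a\<close>, \<open>a \<in> S\<close>, inside the free algebra on
  all indeterminates: the span of the words with letters in \<open>S\<close>.\<close>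

definition free_subalgebra :: "'a set \<Rightarrow> 'a free_algebra set" where
  "free_subalgebra S = {p. \<forall>w\<in>Poly_Mapping.keys p. set (letters w) \<subseteq> S}"

text \<open>The linear functional with prescribed values on the basis of words.\<close>

definition lin_ext :: "('a list \<Rightarrow> complex) \<Rightarrow> 'a free_algebra \<Rightarrow> complex" where
  "lin_ext f p = (\<Sum>w\<in>Poly_Mapping.keys p. Poly_Mapping.lookup p w * f (letters w))"

definition extend_functional :: "('a::ring_1 \<Rightarrow> complex) \<Rightarrow> 'a free_algebra \<Rightarrow> complex" where
  "extend_functional \<psi> = lin_ext (\<lambda>as. \<psi> (prod_list as))"

text \<open>With positions counted from \<open>0\<close>, \<open>rotate i as @ [as ! i]\<close> is
  \<open>(a\<^sub>i, \<dots>, a\<^sub>n\<^sub>-\<^sub>1, a\<^sub>0, \<dots>, a\<^sub>i\<^sub>-\<^sub>1, a\<^sub>i)\<close>. On the empty word the sum is empty.\<close>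

definition W_functional :: "('a::ring_1 \<Rightarrow> complex) \<Rightarrow> 'a free_algebra \<Rightarrow> complex" where
  "W_functional \<phi> =
     lin_ext (\<lambda>as. \<Sum>i<length as. boolean_cumulant \<phi> (rotate i as @ [as ! i]))"

lemma prod_list_indet: "prod_list (map indet as) = Poly_Mapping.single (Word as) 1"
  by (induction as)
     (simp_all add: indet_def mult_single plus_free_word_def flip: single_one zero_free_word_def)

lemma lin_ext_prod_list_indet: "lin_ext f (prod_list (map indet as)) = f as"
  by (simp add: lin_ext_def prod_list_indet)

lemma extend_functional_monomial:
  "extend_functional \<psi> (prod_list (map indet as)) = \<psi> (prod_list as)"
  by (simp add: extend_functional_def lin_ext_prod_list_indet)

lemma W_functional_monomial:
  "W_functional \<phi> (prod_list (map indet as)) =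
     (\<Sum>i<length as. boolean_cumulant \<phi> (drop i as @ take i as @ [as ! i]))"
  unfolding W_functional_def lin_ext_prod_list_indet
  by (intro sum.cong) (auto simp: rotate_drop_take)

end

theory Submission
  imports Defs
begin

text \<open>
  The heart of the matter is that, with \<open>\<beta>\<^sup>\<phi>\<close> extended linearly to the free algebra,
  \<open>\<beta>\<^sup>\<phi> (v P\<^sub>1 \<cdots> P\<^sub>m r) = 0\<close> for nonempty words \<open>v\<close>, \<open>r\<close> and \<open>\<psi>\<close>-centred polynomials \<open>P\<^sub>k\<close>
  whose indices alternate along the whole sequence \<open>v, P\<^sub>1, \<dots>, P\<^sub>m, r\<close> (\<open>v\<close> and \<open>r\<close> need not be
  centred). Expand \<open>\<phi> (v P\<^sub>1 \<cdots> P\<^sub>m r)\<close> over the first block of the interval partitions. By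
  induction all terms vanish whose first block ends inside some \<open>P\<^sub>k\<close> or inside \<open>r\<close>, before its
  last letter. The terms with first block inside \<open>v\<close> add up, by conditional freeness, to
  \<open>\<phi> (v) \<phi> (P\<^sub>1 \<cdots> P\<^sub>m r) = \<phi> (v P\<^sub>1 \<cdots> P\<^sub>m r)\<close>, so nothing is left for the one-block term.

  Each summand of \<open>W \<phi> (P\<^sub>1 \<cdots> P\<^sub>n)\<close> starts and ends with the same letter of some \<open>P\<^sub>k\<close>, so it is
  such a cumulant with \<open>v\<close> and \<open>r\<close> from the algebra of \<open>P\<^sub>k\<close> and the other factors in between.
\<close>

section \<open>Linear extension from words\<close>

text \<open>The target is an arbitrary vector space, so that one set of lemmas serves both
  \<open>lin_ext\<close> and the evaluation \<open>eval_free\<close> into the algebra.\<close>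

definition word_sum ::
    "(complex \<Rightarrow> 'b::ab_group_add \<Rightarrow> 'b) \<Rightarrow> ('a list \<Rightarrow> 'b) \<Rightarrow> 'a free_algebra \<Rightarrow> 'b" where
  "word_sum scale f p =
     (\<Sum>w\<in>Poly_Mapping.keys p. scale (Poly_Mapping.lookup p w) (f (letters w)))"

lemma lin_ext_eq_word_sum: "lin_ext = word_sum (*)"
  by (intro ext) (simp add: lin_ext_def word_sum_def)

lemma vector_space_complex: "vector_space ((*) :: complex \<Rightarrow> complex \<Rightarrow> complex)"
  by unfold_locales (simp_all add: algebra_simps)

lemma vector_space_free_scale: "vector_space free_scale"
  using complex_algebra_free_scale by (rule complex_algebra.axioms(1))

context
  fixes scale :: "complex \<Rightarrow> 'b::ab_group_add \<Rightarrow> 'b"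
  assumes vs: "vector_space scale"
begin

interpretation vector_space scale by (rule vs)

text \<open>Keys may cancel in \<open>p + q\<close>, so additivity is proved by summing over a
  common finite set; the extra words have coefficient 0.\<close>

lemma word_sum_superset:
  assumes "finite S" "Poly_Mapping.keys p \<subseteq> S"
  shows "word_sum scale f p = (\<Sum>w\<in>S. scale (Poly_Mapping.lookup p w) (f (letters w)))"
  unfolding word_sum_def using assms
  by (intro sum.mono_neutral_left) (auto simp: in_keys_iff)

lemma word_sum_add: "word_sum scale f (p + q) = word_sum scale f p + word_sum scale f q"
proof -
  let ?S = "Poly_Mapping.keys p \<union> Poly_Mapping.keys q"
  have "Poly_Mapping.keys (p + q) \<subseteq> ?S" by (rule Poly_Mapping.keys_add)
  then show ?thesis
    by (simp add: word_sum_superset[of ?S] lookup_add scale_left_distrib sum.distrib)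
qed

lemma word_sum_zero: "word_sum scale f 0 = 0"
  by (simp add: word_sum_def)

lemma word_sum_sum: "word_sum scale f (sum g I) = (\<Sum>i\<in>I. word_sum scale f (g i))"
  by (induction I rule: infinite_finite_induct) (simp_all add: word_sum_add word_sum_zero)

lemma word_sum_single: "word_sum scale f (Poly_Mapping.single w c) = scale c (f (letters w))"
  by (subst word_sum_superset[of "{w}"]) auto

lemma word_sum_one: "word_sum scale f 1 = f []"
  by (simp add: word_sum_single zero_free_word_def flip: single_one)

lemma word_sum_scale: "word_sum scale f (free_scale c p) = scale c (word_sum scale f p)"
proof -
  have "Poly_Mapping.keys (free_scale c p) \<subseteq> Poly_Mapping.keys p"
    by (auto simp: in_keys_iff)
  then show ?thesis
    by (simp add: word_sum_superset[of "Poly_Mapping.keys p"] scale_sum_right)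
qed

lemma linear_word_sum: "Vector_Spaces.linear free_scale scale (word_sum scale f)"
  using vector_space_free_scale vs
  by (simp add: Vector_Spaces.linear_iff vector_space_pair_def word_sum_add word_sum_scale)

lemma word_sum_mult:
  "word_sum scale f (p * q) =
     word_sum scale (\<lambda>v. word_sum scale (\<lambda>w. f (v @ w)) q) p"
proof -
  let ?m = "\<lambda>r v. Poly_Mapping.single v (Poly_Mapping.lookup r v) :: 'c free_algebra"
  \<comment> \<open>Each polynomial is the sum of its monomials, and these multiply by concatenating
    words.\<close>
  have m: "r = sum (?m r) (Poly_Mapping.keys r)" for r :: "'c free_algebra"
    by (intro poly_mapping_eqI) (simp add: lookup_sum lookup_single when_def in_keys_iff)
  have "p * q = (\<Sum>v\<in>Poly_Mapping.keys p. \<Sum>w\<in>Poly_Mapping.keys q. ?m p v * ?m q w)"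
    unfolding sum_product[symmetric] using m[of p] m[of q] by (rule arg_cong2)
  then show ?thesis
    by (simp add: word_sum_sum mult_single word_sum_single plus_free_word_def)
       (simp add: word_sum_def scale_sum_right)
qed

lemma word_sum_cong_keys:
  "(\<And>w. w \<in> Poly_Mapping.keys p \<Longrightarrow> f (letters w) = g (letters w)) \<Longrightarrow>
     word_sum scale f p = word_sum scale g p"
  by (simp add: word_sum_def)

lemma word_sum_fun_add: "word_sum scale (\<lambda>w. f w + g w) p = word_sum scale f p + word_sum scale g p"
  by (simp add: word_sum_def scale_right_distrib sum.distrib)

lemma word_sum_fun_sum: "word_sum scale (\<lambda>w. \<Sum>i\<in>I. f i w) p = (\<Sum>i\<in>I. word_sum scale (f i) p)"
  by (simp add: word_sum_def scale_sum_right sum.swap[of _ I])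

lemma word_sum_swap:
  "word_sum scale (\<lambda>v. word_sum scale (f v) q) p =
     word_sum scale (\<lambda>w. word_sum scale (\<lambda>v. f v w) p) q"
  by (simp add: word_sum_def scale_sum_right mult.commute
      sum.swap[of _ "Poly_Mapping.keys p" "Poly_Mapping.keys q"])

end

lemma linear_word_sum_commute:
  assumes "Vector_Spaces.linear s1 s2 h"
  shows "h (word_sum s1 f p) = word_sum s2 (\<lambda>w. h (f w)) p"
proof -
  interpret Vector_Spaces.linear s1 s2 h by (rule assms)
  show ?thesis by (simp add: word_sum_def sum scale)
qed

lemmas lin_ext_one = word_sum_one[OF vector_space_complex, folded lin_ext_eq_word_sum]
  and lin_ext_mult = word_sum_mult[OF vector_space_complex, folded lin_ext_eq_word_sum]
  and lin_ext_fun_add = word_sum_fun_add[OF vector_space_complex, folded lin_ext_eq_word_sum]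
  and lin_ext_fun_sum = word_sum_fun_sum[OF vector_space_complex, folded lin_ext_eq_word_sum]
  and lin_ext_swap = word_sum_swap[OF vector_space_complex, folded lin_ext_eq_word_sum]
  and lin_ext_cong_keys = word_sum_cong_keys[OF vector_space_complex, folded lin_ext_eq_word_sum]
  and linear_lin_ext = linear_word_sum[OF vector_space_complex, folded lin_ext_eq_word_sum]

lemma lin_ext_mult_right: "lin_ext (\<lambda>w. f w * c) p = lin_ext f p * c"
  by (simp add: lin_ext_def sum_distrib_right mult.assoc)

section \<open>First-block recursion for Boolean cumulants\<close>

text \<open>An interval partition is coded by the length \<open>k\<close> of its first block and the
  partition \<open>J\<close> of the remaining positions, renumbered from 0.\<close>

definition cons_interval :: "nat \<Rightarrow> nat set set \<Rightarrow> nat set set" where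
  "cons_interval k J = insert {..<k} ((`) ((+) k) ` J)"

lemma interval_partitions_0: "interval_partitions 0 = {{}}"
  by (auto simp: interval_partitions_def partition_on_def)


lemma cons_interval_in_interval_partitions:
  assumes "1 \<le> k" "k \<le> n" "J \<in> interval_partitions (n - k)"
  shows "cons_interval k J \<in> interval_partitions n"
proof -
  have p: "partition_on {..<n - k} J" and iv: "\<And>B. B \<in> J \<Longrightarrow> \<exists>i j. B = {i..j}"
    using assms(3) by (auto simp: interval_partitions_def)
  have "(+) k ` {..<n - k} = {..<n} - {..<k}"
    using assms(2) by (auto simp: lessThan_atLeast0)
  moreover have "(`) ((+) k) ` J - {{}} = (`) ((+) k) ` J"
    using partition_onD3[OF p] by auto
  ultimately have q: "partition_on ({..<n} - {..<k}) ((`) ((+) k) ` J)"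
    using partition_on_inj_image[OF p, of "(+) k"] by simp
  have "disjnt {..<k} (\<Union>((`) ((+) k) ` J))"
    by (auto simp: disjnt_iff)
  then have "partition_on {..<n} (cons_interval k J)"
    using q assms(1,2) by (simp add: cons_interval_def partition_on_insert lessThan_empty_iff)
  moreover have "\<exists>i j. B = {i..j}" if "B \<in> cons_interval k J" for B
  proof -
    have "{..<k} = {0..k - 1}" using assms(1) by auto
    moreover have "\<exists>i j. (+) k ` C = {i..j}" if "C \<in> J" for C
      using iv[OF that] by (metis image_add_atLeastAtMost)
    ultimately show ?thesis
      using that by (auto simp: cons_interval_def)
  qed
  ultimately show ?thesis by (simp add: interval_partitions_def)
qed

lemma interval_partitions_cases:
  assumes "I \<in> interval_partitions n" "0 < n"
  obtains k J where "1 \<le> k" "k \<le> n" "J \<in> interval_partitions (n - k)" "I = cons_interval k J"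
proof -
  have p: "partition_on {..<n} I" and iv: "\<And>B. B \<in> I \<Longrightarrow> \<exists>i j. B = {i..j}"
    using assms(1) by (auto simp: interval_partitions_def)
  \<comment> \<open>The first block is the one containing 0; being an interval, it is
    \<open>{0..j}\<close> and has length \<open>Suc j\<close>.\<close>
  obtain B where B: "B \<in> I" "0 \<in> B"
    using partition_onD1[OF p] assms(2) by blast
  then obtain j where "B = {0..j}"
    using iv by fastforce
  define k where "k = Suc j"
  have Bk: "B = {..<k}" and k: "1 \<le> k"
    using \<open>B = {0..j}\<close> by (auto simp: k_def)
  have "B \<subseteq> {..<n}"
    using partition_onD1[OF p] B(1) by blast
  then have kn: "k \<le> n"
    by (simp add: Bk lessThan_subset_iff)
  have dj: "disjnt B (\<Union>(I - {B}))"
    using partition_onD2[OF p] B(1) by (auto simp: disjnt_def disjoint_def)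
  have q: "partition_on ({..<n} - {..<k}) (I - {B})"
    using partition_on_insert[OF dj, of "{..<n}"] p B(1) by (simp add: insert_absorb Bk)
  define J where "J = (-`) ((+) k) ` (I - {B})"
  \<comment> \<open>The other blocks lie in \<open>{k..}\<close>, so shifting them down by preimages
    loses no element and creates no empty block.\<close>
  have ge: "C \<subseteq> {k..}" "C \<noteq> {}" if "C \<in> I - {B}" for C
  proof -
    show "C \<subseteq> {k..}"
      using partition_onD1[OF q] that by fastforce
    show "C \<noteq> {}"
      using partition_onD3[OF q] that by blast
  qed
  have shift: "(+) k ` ((+) k -` C) = C" if "C \<in> I - {B}" for C
    using ge(1)[OF that] by (force simp: image_iff le_iff_add)
  have "(+) k -` ({..<n} - {..<k}) = {..<n - k}"
    by auto
  moreover have "{} \<notin> J"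
  proof
    assume "{} \<in> J"
    then obtain C where "C \<in> I - {B}" "(+) k -` C = {}"
      by (force simp: J_def)
    then show False
      using shift[of C] ge(2)[of C] by simp
  qed
  then have "J - {{}} = J" by simp
  ultimately have "partition_on {..<n - k} J"
    using partition_on_vimage[OF q, of "(+) k"] by (simp add: J_def)
  moreover have "\<exists>a b. (+) k -` C = {a..b}" if C: "C \<in> I - {B}" for C
  proof -
    obtain a b where ab: "C = {a..b}" using iv C by blast
    have "(+) k -` {a..b} = {a - k..b - k}" if "k \<le> a" "a \<le> b"
      using that by auto
    then show ?thesis
      using ge[OF C] ab by (metis atLeastatMost_empty_iff2 atLeast_iff atLeastAtMost_iff
          order_refl subset_iff)
  qed
  ultimately have "J \<in> interval_partitions (n - k)"
    by (auto simp: interval_partitions_def J_def)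
  moreover have "(`) ((+) k) ` J = (\<lambda>C. C) ` (I - {B})"
    unfolding J_def image_image by (intro image_cong refl shift)
  then have "I = cons_interval k J"
    using B(1) by (auto simp: cons_interval_def Bk)
  ultimately show ?thesis using that k kn by blast
qed

text \<open>For injectivity, \<open>k\<close> is read off as the size of the block containing 0, and
  \<open>J\<close> as the preimages of the blocks under the shift, without the empty preimage of the
  first block.\<close>

lemma bij_betw_cons_interval:
  assumes "0 < n"
  shows "bij_betw (\<lambda>(k, J). cons_interval k J)
    (SIGMA k:{1..n}. interval_partitions (n - k)) (interval_partitions n)"
  unfolding bij_betw_def
proof (intro conjI inj_onI)
  have size: "card (\<Union>{B \<in> cons_interval k J. 0 \<in> B}) = k" if "1 \<le> k" for k J
  proof -
    have "{B \<in> cons_interval k J. 0 \<in> B} = {{..<k}}"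
      using that by (auto simp: cons_interval_def)
    then show ?thesis by simp
  qed
  have rest: "(-`) ((+) k) ` cons_interval k J - {{}} = J" if "J \<in> interval_partitions m" for k J m
  proof -
    have "{} \<notin> J" "(+) k -` {..<k} = {}"
      using that by (auto simp: interval_partitions_def partition_on_def)
    then show ?thesis
      by (simp add: cons_interval_def image_image inj_vimage_image_eq)
  qed
  fix a b
  assume a: "a \<in> (SIGMA k:{1..n}. interval_partitions (n - k))"
    and b: "b \<in> (SIGMA k:{1..n}. interval_partitions (n - k))"
    and eq: "(case a of (k, J) \<Rightarrow> cons_interval k J) = (case b of (k, J) \<Rightarrow> cons_interval k J)"
  obtain k J l K where kJ: "a = (k, J)" "b = (l, K)" by fastforce
  have "k = l"
    using size[of k J] size[of l K] a b eq by (simp add: kJ)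
  moreover have "J = K"
  proof -
    have "J = (-`) ((+) k) ` cons_interval k J - {{}}"
      using a by (intro rest[symmetric, of _ "n - k"]) (simp add: kJ)
    also have "cons_interval k J = cons_interval l K"
      using eq by (simp add: kJ)
    also have "(-`) ((+) k) ` cons_interval l K - {{}} = K"
      unfolding \<open>k = l\<close> using b by (intro rest[of _ "n - l"]) (simp add: kJ)
    finally show ?thesis .
  qed
  ultimately show "a = b" by (simp add: kJ)
next
  show "(\<lambda>(k, J). cons_interval k J) ` (SIGMA k:{1..n}. interval_partitions (n - k)) =
    interval_partitions n"
  proof (intro equalityI subsetI)
    fix I assume "I \<in> interval_partitions n"
    then obtain k J where "1 \<le> k" "k \<le> n" "J \<in> interval_partitions (n - k)" "I = cons_interval k J"
      using interval_partitions_cases assms by blast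
    then show "I \<in> (\<lambda>(k, J). cons_interval k J) ` (SIGMA k:{1..n}. interval_partitions (n - k))"
      by (intro image_eqI[of _ _ "(k, J)"]) auto
  qed (auto intro: cons_interval_in_interval_partitions)
qed

lemma prod_boolean_cumulant_cons_interval:
  assumes "J \<in> interval_partitions m" "1 \<le> k"
  shows "(\<Prod>B\<in>cons_interval k J. boolean_cumulant \<phi> (nths as B)) =
    boolean_cumulant \<phi> (take k as) * (\<Prod>B\<in>J. boolean_cumulant \<phi> (nths (drop k as) B))"
proof -
  have "finite J"
    using assms(1) finite_elements[of "{..<m}"] by (auto simp: interval_partitions_def)
  \<comment> \<open>Since \<open>1 \<le> k\<close>, 0 lies in the first block but in no shifted one,
    so the insertion adds a new factor.\<close>
  moreover have "{..<k} \<notin> (`) ((+) k) ` J"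
    using assms(2) by force
  moreover have "inj_on ((`) ((+) k)) J"
    by (intro inj_onI) (simp add: inj_image_eq_iff)
  ultimately show ?thesis
    by (simp add: cons_interval_def prod.reindex nths_drop)
qed

text \<open>Interval partitions are grouped by their first block; for each \<open>k\<close> the
  remaining blocks sum to the moment of \<open>drop k as\<close>.\<close>

lemma moment_first_block:
  assumes "as \<noteq> []" "\<phi> 1 = 1"
  shows "\<phi> (prod_list as) =
    (\<Sum>k=1..length as. boolean_cumulant \<phi> (take k as) * \<phi> (prod_list (drop k as)))"
proof -
  let ?n = "length as" and ?\<beta> = "boolean_cumulant \<phi>"
  \<comment> \<open>The empty list is needed for \<open>k = length as\<close>; its only partition is
    empty, with product 1, which is \<open>\<phi> 1\<close>.\<close>
  have moment: "\<phi> (prod_list bs) = (\<Sum>J\<in>interval_partitions (length bs). \<Prod>B\<in>J. ?\<beta> (nths bs B))" for bs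
    using moment_boolean_cumulant[of bs \<phi>] assms(2)
    by (cases "bs = []") (simp_all add: interval_partitions_0)
  have "\<phi> (prod_list as) = (\<Sum>(k, J)\<in>(SIGMA k:{1..?n}. interval_partitions (?n - k)).
      \<Prod>B\<in>cons_interval k J. ?\<beta> (nths as B))"
    using sum.reindex_bij_betw[OF bij_betw_cons_interval[of ?n],
        of "\<lambda>I. \<Prod>B\<in>I. ?\<beta> (nths as B)"] assms(1)
    by (simp add: moment[of as] case_prod_unfold)
  also have "\<dots> = (\<Sum>k=1..?n. \<Sum>J\<in>interval_partitions (?n - k).
      \<Prod>B\<in>cons_interval k J. ?\<beta> (nths as B))"
    by (simp add: sum.Sigma finite_interval_partitions)
  also have "\<dots> = (\<Sum>k=1..?n. \<Sum>J\<in>interval_partitions (?n - k).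
      ?\<beta> (take k as) * (\<Prod>B\<in>J. ?\<beta> (nths (drop k as) B)))"
    by (intro sum.cong refl prod_boolean_cumulant_cons_interval) auto
  finally show ?thesis
    by (simp add: moment sum_distrib_left)
qed

text \<open>For \<open>w \<noteq> []\<close>, the part of the expansion of \<open>\<phi> (w x)\<close> whose first block ends inside \<open>w\<close>.\<close>

definition first_block_sum :: "('a::ring_1 \<Rightarrow> complex) \<Rightarrow> 'a list \<Rightarrow> 'a \<Rightarrow> complex" where
  "first_block_sum \<phi> w x =
     (\<Sum>k=1..length w. boolean_cumulant \<phi> (take k w) * \<phi> (prod_list (drop k w) * x))"

lemma first_block_sum_one:
  "w \<noteq> [] \<Longrightarrow> \<phi> 1 = 1 \<Longrightarrow> first_block_sum \<phi> w 1 = \<phi> (prod_list w)"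
  by (simp add: first_block_sum_def moment_first_block[of w])

text \<open>The first block either ends inside \<open>v\<close>, and then \<open>u\<close> belongs
  to the rest, or contains \<open>v\<close> and ends inside \<open>u\<close>.\<close>

lemma first_block_sum_append:
  "first_block_sum \<phi> (v @ u) x = first_block_sum \<phi> v (prod_list u * x) +
     (\<Sum>k=1..length u. boolean_cumulant \<phi> (v @ take k u) * \<phi> (prod_list (drop k u) * x))"
proof -
  let ?g = "\<lambda>k. boolean_cumulant \<phi> (take k (v @ u)) * \<phi> (prod_list (drop k (v @ u)) * x)"
  have "first_block_sum \<phi> (v @ u) x = sum ?g {1..length v + length u}"
    by (simp add: first_block_sum_def)
  also have "\<dots> = sum ?g {1..length v} + sum ?g {length v + 1..length v + length u}"
    by (rule sum.ub_add_nat) simp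
  also have "sum ?g {length v + 1..length v + length u} = (\<Sum>k=1..length u. ?g (k + length v))"
    using sum.shift_bounds_cl_nat_ivl[of ?g 1 "length v" "length u"] by (simp add: add.commute)
  finally show ?thesis
    by (simp add: first_block_sum_def mult.assoc)
qed

section \<open>The cyclic functional\<close>

text \<open>The summands of \<open>W \<phi>\<close> at the cyclic word \<open>u v\<close> that repeat a letter of \<open>u\<close>.\<close>

definition cyclic_cut :: "('a::ring_1 \<Rightarrow> complex) \<Rightarrow> 'a list \<Rightarrow> 'a list \<Rightarrow> complex" where
  "cyclic_cut \<phi> u v =
     (\<Sum>i<length u. boolean_cumulant \<phi> (drop i u @ v @ take i u @ [u ! i]))"

text \<open>Bilinear extension of \<open>cyclic_cut\<close>: in
  \<open>W_functional \<phi> (p * q)\<close> it collects the summands whose repeated letter comes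
  from \<open>p\<close>.\<close>

definition cyclic_pairing ::
    "('a::ring_1 \<Rightarrow> complex) \<Rightarrow> 'a free_algebra \<Rightarrow> 'a free_algebra \<Rightarrow> complex" where
  "cyclic_pairing \<phi> p q = lin_ext (\<lambda>u. lin_ext (cyclic_cut \<phi> u) q) p"

text \<open>The repeated letter lies in \<open>u\<close> or in \<open>u'\<close>; in the second case
  the cyclic word is read from the start of \<open>u'\<close>, so \<open>u\<close> moves behind
  \<open>v\<close>.\<close>

lemma cyclic_cut_append:
  "cyclic_cut \<phi> (u @ u') v = cyclic_cut \<phi> u (u' @ v) + cyclic_cut \<phi> u' (v @ u)"
proof -
  let ?g = "\<lambda>i. boolean_cumulant \<phi>
    (drop i (u @ u') @ v @ take i (u @ u') @ [(u @ u') ! i])"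
  have split: "sum g {..<m + n} = sum g {..<m} + (\<Sum>i<n. g (m + i))"
    for g :: "nat \<Rightarrow> complex" and m n
    by (induction n) (simp_all add: add.assoc)
  have "cyclic_cut \<phi> (u @ u') v = sum ?g {..<length u + length u'}"
    by (simp add: cyclic_cut_def)
  also have "\<dots> = sum ?g {..<length u} + (\<Sum>i<length u'. ?g (length u + i))"
    by (rule split)
  finally show ?thesis
    by (simp add: cyclic_cut_def nth_append)
qed

lemma W_functional_eq_cyclic_pairing: "W_functional \<phi> p = cyclic_pairing \<phi> p 1"
proof -
  have "(\<Sum>i<length u. boolean_cumulant \<phi> (rotate i u @ [u ! i])) = cyclic_cut \<phi> u []" for u
    unfolding cyclic_cut_def by (intro sum.cong) (auto simp: rotate_drop_take)
  then show ?thesis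
    by (simp add: W_functional_def cyclic_pairing_def lin_ext_one)
qed

lemma cyclic_pairing_one: "cyclic_pairing \<phi> 1 q = 0"
  by (simp add: cyclic_pairing_def lin_ext_one) (simp add: lin_ext_def cyclic_cut_def)

lemma cyclic_pairing_mult:
  "cyclic_pairing \<phi> (p * p') q = cyclic_pairing \<phi> p (p' * q) + cyclic_pairing \<phi> p' (q * p)"
proof -
  \<comment> \<open>In the second summand of \<open>cyclic_cut_append\<close> the letters of
    \<open>p\<close> come after those of \<open>q\<close>; two exchanges of sums make
    \<open>p\<close> innermost, as the product \<open>q * p\<close> requires.\<close>
  have "lin_ext (\<lambda>u. lin_ext (\<lambda>u'. lin_ext (\<lambda>v. cyclic_cut \<phi> u' (v @ u)) q) p') p =
      lin_ext (\<lambda>u'. lin_ext (\<lambda>u. lin_ext (\<lambda>v. cyclic_cut \<phi> u' (v @ u)) q) p) p'"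
    by (rule lin_ext_swap)
  also have "\<dots> = lin_ext (\<lambda>u'. lin_ext (\<lambda>v. lin_ext (\<lambda>u. cyclic_cut \<phi> u' (v @ u)) p) q) p'"
    by (subst (2) lin_ext_swap) (rule refl)
  also have "\<dots> = cyclic_pairing \<phi> p' (q * p)"
    by (simp add: cyclic_pairing_def lin_ext_mult)
  finally show ?thesis
    by (simp add: cyclic_pairing_def lin_ext_mult cyclic_cut_append[abs_def] lin_ext_fun_add)
qed

lemma W_functional_mult:
  "W_functional \<phi> (p * q) = cyclic_pairing \<phi> p q + cyclic_pairing \<phi> q p"
  by (simp add: W_functional_eq_cyclic_pairing cyclic_pairing_mult)

text \<open>Traciality holds because the formula \<open>W_functional_mult\<close> is symmetric in
  \<open>p\<close> and \<open>q\<close>.\<close>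

lemma tracial_W_functional: "tracial_functional free_scale (W_functional \<phi>)"
  by (simp add: tracial_functional_def W_functional_mult add.commute linear_functional_def)
     (simp add: W_functional_def linear_lin_ext)

text \<open>By \<open>cyclic_pairing_mult\<close> the pairing of a product splits into one term per
  factor, each paired with the other factors in the cyclic order that starts behind it. The
  induction moves the last factor of \<open>X\<close> to the front of \<open>Y\<close>.\<close>

lemma cyclic_pairing_prod_list:
  assumes "\<And>X p Y. ps = X @ p # Y \<Longrightarrow> cyclic_pairing \<phi> p (prod_list Y * prod_list X) = 0"
    and "ps = X @ Y"
  shows "cyclic_pairing \<phi> (prod_list X) (prod_list Y) = 0"
  using assms(2)
proof (induction X arbitrary: Y rule: rev_induct)
  case (snoc p X)
  then show ?case
    using assms(1)[of X p Y] snoc.IH[of "p # Y"] by (simp add: cyclic_pairing_mult)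
qed (simp add: cyclic_pairing_one)

section \<open>Algebras on a set of indeterminates\<close>

lemma unital_subalgebra_free_subalgebra: "unital_subalgebra free_scale (free_subalgebra S)"
proof -
  interpret vector_space free_scale by (rule vector_space_free_scale)
  have "subspace (free_subalgebra S)"
    unfolding subspace_def
  proof (intro conjI ballI allI)
    fix p q :: "'a free_algebra" and c
    assume pq: "p \<in> free_subalgebra S" "q \<in> free_subalgebra S"
    show "p + q \<in> free_subalgebra S"
      using pq Poly_Mapping.keys_add[of p q] by (auto simp: free_subalgebra_def)
  next
    fix p :: "'a free_algebra" and c
    assume "p \<in> free_subalgebra S"
    then show "free_scale c p \<in> free_subalgebra S"
      by (auto simp: free_subalgebra_def in_keys_iff)
  qed (simp add: free_subalgebra_def)
  moreover have "p * q \<in> free_subalgebra S"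
    if "p \<in> free_subalgebra S" "q \<in> free_subalgebra S" for p q
    using that keys_mult[of p q] by (fastforce simp: free_subalgebra_def plus_free_word_def)
  moreover have "1 \<in> free_subalgebra S"
    by (simp add: free_subalgebra_def zero_free_word_def)
  ultimately show ?thesis
    by (simp add: unital_subalgebra_def)
qed

section \<open>Alternating lists\<close>

text \<open>The new neighbours are the last and the first entry of the list, distinct by assumption;
  this also excludes that \<open>xs\<close> and \<open>ys\<close> are both empty.\<close>

lemma distinct_adj_rotate_around:
  assumes "distinct_adj (xs @ l # ys)" "last (xs @ l # ys) \<noteq> hd (xs @ l # ys)"
  shows "distinct_adj (l # ys @ xs @ [l])"
  using assms by (cases xs; cases ys rule: rev_cases)
    (auto simp: distinct_adj_append_iff distinct_adj_Cons hd_append)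

text \<open>List form of \<open>alternating_centred\<close>, in which factors are easily split off,
  appended and rotated.\<close>

definition alternating_list ::
    "('a \<Rightarrow> complex) \<Rightarrow> 'a set \<Rightarrow> 'a set \<Rightarrow> (nat \<times> 'a) list \<Rightarrow> bool" where
  "alternating_list \<psi> A1 A2 js \<longleftrightarrow>
     (\<forall>(j, x)\<in>set js. j \<in> {1, 2} \<and> x \<in> (if j = 1 then A1 else A2) \<and> \<psi> x = 0) \<and>
     distinct_adj (map fst js)"

lemma alternating_centred_iff_list:
  "alternating_centred \<psi> A1 A2 n j a \<longleftrightarrow>
     alternating_list \<psi> A1 A2 (map (\<lambda>k. (j k, a k)) [1..<n + 1])"
proof -
  have "(\<forall>k\<in>{1..<n}. j k \<noteq> j (k + 1)) \<longleftrightarrow> (\<forall>i. Suc i < n \<longrightarrow> j (Suc i) \<noteq> j (Suc (Suc i)))"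
    by (auto simp: Ball_def) (metis Suc_le_D Suc_eq_plus1)
  then show ?thesis
    by (auto simp: alternating_centred_def alternating_list_def distinct_adj_conv_nth o_def
        simp del: upt_Suc)
qed

lemma oprod_eq_prod_list: "oprod n a = prod_list (map snd (map (\<lambda>k. (j k, a k)) [1..<n + 1]))"
  by (simp add: oprod_def o_def del: upt_Suc)

lemma conditionally_free_list:
  assumes "conditionally_free \<psi> \<phi> A1 A2" "alternating_list \<psi> A1 A2 js" "js \<noteq> []"
  shows "\<psi> (prod_list (map snd js)) = 0"
    and "\<phi> (prod_list (map snd js)) = prod_list (map (\<phi> \<circ> snd) js)"
proof -
  \<comment> \<open>Factors are numbered from 1 in the definition, from 0 in the list.\<close>
  define j a where "j k = fst (js ! (k - 1))" and "a k = snd (js ! (k - 1))" for k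
  have js: "map (\<lambda>k. (j k, a k)) [1..<length js + 1] = js"
    by (intro nth_equalityI) (simp_all add: j_def a_def del: upt_Suc)
  have alt: "alternating_centred \<psi> A1 A2 (length js) j a"
    using assms(2) by (simp only: alternating_centred_iff_list js)
  have o: "oprod (length js) a = prod_list (map snd js)"
    by (simp only: oprod_eq_prod_list[of _ _ j] js)
  have "(\<Prod>k=1..length js. \<phi> (a k)) = prod_list (map (\<phi> \<circ> a) [1..<length js + 1])"
    by (simp add: prod.list_conv_set_nth prod.atLeast1_atMost_eq del: upt_Suc)
       (simp add: atLeast0LessThan)
  also have "\<dots> = prod_list (map (\<phi> \<circ> snd) js)"
    by (subst (2) js[symmetric]) (simp add: o_def del: upt_Suc)
  finally have p: "(\<Prod>k=1..length js. \<phi> (a k)) = prod_list (map (\<phi> \<circ> snd) js)" .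
  have "1 \<le> length js"
    using assms(3) by (simp add: Suc_le_eq)
  then have "\<psi> (oprod (length js) a) = 0 \<and> \<phi> (oprod (length js) a) = (\<Prod>k=1..length js. \<phi> (a k))"
    using assms(1) alt unfolding conditionally_free_def by blast
  then show "\<psi> (prod_list (map snd js)) = 0"
    "\<phi> (prod_list (map snd js)) = prod_list (map (\<phi> \<circ> snd) js)"
    by (simp_all only: o p)
qed

section \<open>Vanishing mixed Boolean cumulants\<close>

locale conditionally_free_pair = complex_algebra scale
  for scale :: "complex \<Rightarrow> 'a::ring_1 \<Rightarrow> 'a" +
  fixes \<psi> \<phi> :: "'a \<Rightarrow> complex" and A1 A2 :: "'a set"
  assumes psi: "unital_functional scale \<psi>"
    and phi: "unital_functional scale \<phi>"
    and A1: "unital_subalgebra scale A1"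
    and A2: "unital_subalgebra scale A2"
    and cfree: "conditionally_free \<psi> \<phi> A1 A2"
begin

section \<open>Evaluation of free polynomials\<close>

definition part :: "nat \<Rightarrow> 'a set" where
  "part j = (if j = 1 then A1 else A2)"

text \<open>The algebra homomorphism that sends each \<open>indet a\<close> to \<open>a\<close>; the
  extension of \<open>\<psi>\<close> is \<open>\<psi>\<close> after it.\<close>

definition eval_free :: "'a free_algebra \<Rightarrow> 'a" where
  "eval_free = word_sum scale prod_list"

lemma part_subalgebra: "unital_subalgebra scale (part j)"
  using A1 A2 by (simp add: part_def)

lemma one_in_part: "1 \<in> part j"
  using part_subalgebra by (simp add: unital_subalgebra_def)

lemma scale_in_part: "x \<in> part j \<Longrightarrow> scale c x \<in> part j"
  using part_subalgebra subspace_scale by (auto simp: unital_subalgebra_def)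

lemma diff_in_part: "x \<in> part j \<Longrightarrow> y \<in> part j \<Longrightarrow> x - y \<in> part j"
  using part_subalgebra subspace_diff by (auto simp: unital_subalgebra_def)

lemma prod_list_in_part: "set w \<subseteq> part j \<Longrightarrow> prod_list w \<in> part j"
  using part_subalgebra one_in_part by (induction w) (auto simp: unital_subalgebra_def)

lemma linear_psi: "Vector_Spaces.linear scale (*) \<psi>" and psi_one: "\<psi> 1 = 1"
  using psi by (simp_all add: unital_functional_def linear_functional_def)

lemma linear_phi: "Vector_Spaces.linear scale (*) \<phi>" and phi_one: "\<phi> 1 = 1"
  using phi by (simp_all add: unital_functional_def linear_functional_def)

lemma phi_add: "\<phi> (x + y) = \<phi> x + \<phi> y" and phi_scale: "\<phi> (scale c x) = c * \<phi> x"
  using linear_phi by (simp_all add: Vector_Spaces.linear_iff)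

lemma eval_free_mult: "eval_free (p * q) = eval_free p * eval_free q"
proof -
  have "eval_free (p * q) = word_sum scale (\<lambda>v. word_sum scale (\<lambda>w. prod_list v * prod_list w) q) p"
    by (simp add: eval_free_def word_sum_mult[OF vector_space_axioms])
  also have "\<dots> = word_sum scale (\<lambda>v. prod_list v * eval_free q) p"
    by (simp add: word_sum_def eval_free_def sum_distrib_left scale_mult_right)
  also have "\<dots> = eval_free p * eval_free q"
    by (simp add: word_sum_def eval_free_def sum_distrib_right scale_mult_left)
  finally show ?thesis .
qed

lemma eval_free_one: "eval_free 1 = 1"
  by (simp add: eval_free_def word_sum_one[OF vector_space_axioms])

lemma eval_free_prod_list: "eval_free (prod_list ps) = prod_list (map eval_free ps)"
  by (induction ps) (simp_all add: eval_free_mult eval_free_one)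

lemma lin_ext_linear:
  assumes "Vector_Spaces.linear scale (*) h"
  shows "lin_ext (\<lambda>w. h (prod_list w)) p = h (eval_free p)"
  using linear_word_sum_commute[OF assms, of prod_list p]
  by (simp add: eval_free_def lin_ext_eq_word_sum)

lemma extend_psi: "extend_functional \<psi> p = \<psi> (eval_free p)"
  unfolding extend_functional_def by (rule lin_ext_linear[OF linear_psi])

lemma linear_phi_mult: "Vector_Spaces.linear scale (*) (\<lambda>x. \<phi> (y * x * z))"
  using linear_phi
  by (simp add: Vector_Spaces.linear_iff distrib_left distrib_right
      flip: scale_mult_right scale_mult_left)

lemma linear_first_block_sum:
  "Vector_Spaces.linear scale (*) (\<lambda>x. first_block_sum \<phi> w (x * y))"
  unfolding Vector_Spaces.linear_iff
proof (intro conjI allI)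
  fix x z c
  show "first_block_sum \<phi> w ((x + z) * y) = first_block_sum \<phi> w (x * y) + first_block_sum \<phi> w (z * y)"
    by (simp add: first_block_sum_def algebra_simps phi_add sum.distrib)
  show "first_block_sum \<phi> w (scale c x * y) = c * first_block_sum \<phi> w (x * y)"
    by (simp add: first_block_sum_def sum_distrib_left phi_scale mult.left_commute
        flip: scale_mult_right scale_mult_left)
qed (rule vector_space_axioms vector_space_complex)+

lemma eval_free_in_part:
  assumes "p \<in> free_subalgebra (part j)"
  shows "eval_free p \<in> part j"
  unfolding eval_free_def word_sum_def
  using assms part_subalgebra[of j]
  by (intro subspace_sum scale_in_part prod_list_in_part)
     (auto simp: free_subalgebra_def unital_subalgebra_def)

section \<open>Moments of alternating products\<close>

abbreviation "alternating \<equiv> alternating_list \<psi> A1 A2"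

abbreviation "free_alternating \<equiv>
  alternating_list (extend_functional \<psi>) (free_subalgebra A1) (free_subalgebra A2)"

lemma alternating_eval_free:
  "free_alternating ps \<Longrightarrow> alternating (map (\<lambda>(j, p). (j, eval_free p)) ps)"
  using eval_free_in_part[of _ 1] eval_free_in_part[of _ 2]
  by (fastforce simp: alternating_list_def extend_psi part_def o_def case_prod_unfold)

text \<open>Writing \<open>x\<close> and \<open>y\<close> as a centred part plus a scalar leaves
  four alternating centred products. Conditional freeness evaluates each of them, and they add up to
  \<open>\<phi> x * ?F * \<phi> y\<close>.\<close>

lemma phi_mult_alternating:
  assumes "alternating ms" "i \<in> {1, 2}" "l \<in> {1, 2}" "distinct_adj (i # map fst ms @ [l])"
    and "x \<in> part i" "y \<in> part l"
  shows "\<phi> (x * prod_list (map snd ms) * y) = \<phi> x * \<phi> (prod_list (map snd ms) * y)"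
proof -
  let ?M = "prod_list (map snd ms)" and ?F = "prod_list (map (\<phi> \<circ> snd) ms)"
  define x0 y0 where "x0 = x - scale (\<psi> x) 1" and "y0 = y - scale (\<psi> y) 1"
  have cent: "\<psi> (z - scale (\<psi> z) 1) = 0" for z
  proof -
    have "\<psi> (z - scale (\<psi> z) 1 + scale (\<psi> z) 1) = \<psi> (z - scale (\<psi> z) 1) + \<psi> z * \<psi> 1"
      using linear_psi by (simp only: Vector_Spaces.linear_iff)
    then show ?thesis by (simp add: psi_one)
  qed
  have x0: "x0 \<in> part i" "\<psi> x0 = 0" and y0: "y0 \<in> part l" "\<psi> y0 = 0"
    using assms(5,6) by (auto simp: x0_def y0_def cent intro!: diff_in_part scale_in_part one_in_part)
  have x: "x = x0 + scale (\<psi> x) 1" and y: "y = y0 + scale (\<psi> y) 1"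
    by (simp_all add: x0_def y0_def)
  have "\<phi> (x0 * ?M * y0) = \<phi> x0 * ?F * \<phi> y0"
    using conditionally_free_list(2)[OF cfree, of "(i, x0) # ms @ [(l, y0)]"] assms x0 y0
    by (auto simp: alternating_list_def part_def mult.assoc)
  moreover have "\<phi> (x0 * ?M) = \<phi> x0 * ?F"
    using conditionally_free_list(2)[OF cfree, of "(i, x0) # ms"] assms x0
    by (auto simp: alternating_list_def part_def distinct_adj_append_iff[of "i # map fst ms"] simp flip: append_Cons)
  moreover have "\<phi> (?M * y0) = ?F * \<phi> y0"
    using conditionally_free_list(2)[OF cfree, of "ms @ [(l, y0)]"] assms y0
    by (auto simp: alternating_list_def part_def dest: distinct_adj_ConsD)
  \<comment> \<open>For empty \<open>ms\<close> the middle product is 1, and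
    \<open>\<phi> 1 = 1\<close> replaces conditional freeness.\<close>
  moreover have "\<phi> ?M = ?F"
    using conditionally_free_list(2)[OF cfree, of ms] assms(1)
    by (cases "ms = []") (auto simp: phi_one)
  moreover have right: "z * y = z * y0 + scale (\<psi> y) z" for z
    using distrib_left[of z y0 "scale (\<psi> y) 1"] by (simp flip: y scale_mult_right)
  moreover have "x * ?M * y = x0 * ?M * y + scale (\<psi> x) (?M * y)"
    using distrib_right[of x0 "scale (\<psi> x) 1" "?M * y"]
    by (simp add: mult.assoc flip: x scale_mult_left)
  moreover have "\<phi> x = \<phi> x0 + \<psi> x"
    by (subst x) (simp add: phi_add phi_scale phi_one)
  ultimately show ?thesis
    by (simp add: phi_add phi_scale right[of "x0 * ?M"] right[of ?M]) (simp add: algebra_simps)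
qed

text \<open>The moment of the middle product times \<open>y\<close> is a common factor of all terms;
  what remains is the first-block expansion of \<open>\<phi> (prod_list v)\<close>.\<close>

lemma first_block_sum_alternating:
  assumes "free_alternating ps" "i \<in> {1, 2}" "l \<in> {1, 2}" "distinct_adj (i # map fst ps @ [l])"
    and "set v \<subseteq> part i" "v \<noteq> []" "y \<in> part l"
  shows "first_block_sum \<phi> v (eval_free (prod_list (map snd ps)) * y) =
    \<phi> (prod_list v * eval_free (prod_list (map snd ps)) * y)"
proof -
  define ms where "ms = map (\<lambda>(j, p). (j, eval_free p)) ps"
  have ms: "alternating ms" "map fst ms = map fst ps"
    and M: "eval_free (prod_list (map snd ps)) = prod_list (map snd ms)"
    using alternating_eval_free[OF assms(1)]
    by (simp_all add: ms_def eval_free_prod_list o_def case_prod_unfold)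
  \<comment> \<open>The left factor need not be centred, so \<open>u\<close> may be any suffix of
    \<open>v\<close>, even the empty one.\<close>
  have split: "\<phi> (prod_list u * prod_list (map snd ms) * y) =
      \<phi> (prod_list u) * \<phi> (prod_list (map snd ms) * y)" if "set u \<subseteq> set v" for u
    using assms ms that
    by (intro phi_mult_alternating[where i = i and l = l] prod_list_in_part) auto
  have "first_block_sum \<phi> v (prod_list (map snd ms) * y) =
      (\<Sum>k=1..length v. boolean_cumulant \<phi> (take k v) * \<phi> (prod_list (drop k v))) *
      \<phi> (prod_list (map snd ms) * y)"
    unfolding first_block_sum_def sum_distrib_right
    by (intro sum.cong refl) (simp add: split set_drop_subset flip: mult.assoc)
  also have "\<dots> = \<phi> (prod_list v * prod_list (map snd ms) * y)"
    using moment_first_block[of v \<phi>] assms(6) by (simp add: split phi_one)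
  finally show ?thesis by (simp add: M)
qed

section \<open>Vanishing by induction on the number of factors\<close>

text \<open>In the first-block expansion of \<open>\<phi> (v p x)\<close> no block ending inside \<open>p\<close> contributes.\<close>

definition splits_after_first :: "'a list \<Rightarrow> 'a free_algebra \<Rightarrow> bool" where
  "splits_after_first v p \<longleftrightarrow>
     (\<forall>x. lin_ext (\<lambda>w. first_block_sum \<phi> (v @ w) x) p = first_block_sum \<phi> v (eval_free p * x))"

text \<open>The splitting property is a hypothesis here because its own induction over the factors
  relies on this vanishing for fewer factors.\<close>

lemma boolean_cumulant_vanishes_step:
  assumes "splits_after_first v (prod_list (map snd ps))"
    and "free_alternating ps" "i \<in> {1, 2}" "l \<in> {1, 2}" "distinct_adj (i # map fst ps @ [l])"
    and "set v \<subseteq> part i" "v \<noteq> []" "set r \<subseteq> part l" "r \<noteq> []"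
  shows "lin_ext (\<lambda>w. boolean_cumulant \<phi> (v @ w @ r)) (prod_list (map snd ps)) = 0"
  using assms(8,9)
proof (induction "length r" arbitrary: r rule: less_induct)
  case less
  let ?p = "prod_list (map snd ps)" and ?\<beta> = "boolean_cumulant \<phi>"
  \<comment> \<open>For \<open>k < length r\<close> the prefix \<open>take k r\<close> is nonempty
    and shorter, so the induction hypothesis applies; only the one-block term survives.\<close>
  have "lin_ext (\<lambda>w. ?\<beta> (v @ w @ take k r) * \<phi> (prod_list (drop k r))) ?p =
      (if k = length r then lin_ext (\<lambda>w. ?\<beta> (v @ w @ r)) ?p else 0)" if "k \<in> {1..length r}" for k
  proof (cases "k = length r")
    case False
    then have "lin_ext (\<lambda>w. ?\<beta> (v @ w @ take k r)) ?p = 0"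
      using that less.prems by (intro less.hyps) (auto dest: in_set_takeD)
    with False show ?thesis by (simp add: lin_ext_mult_right)
  qed (simp add: phi_one)
  then have tail: "(\<Sum>k=1..length r. lin_ext (\<lambda>w. ?\<beta> (v @ w @ take k r) * \<phi> (prod_list (drop k r))) ?p) =
      lin_ext (\<lambda>w. ?\<beta> (v @ w @ r)) ?p"
    using less.prems by (simp add: Suc_le_eq)
  \<comment> \<open>The chain expands this moment by its first block and returns to the same moment
    plus the one-block term, which must therefore vanish.\<close>
  have "\<phi> (prod_list v * eval_free ?p * prod_list r) =
      lin_ext (\<lambda>w. \<phi> (prod_list v * prod_list w * prod_list r)) ?p"
    by (rule lin_ext_linear[OF linear_phi_mult, symmetric])
  also have "\<dots> = lin_ext (\<lambda>w. first_block_sum \<phi> ((v @ w) @ r) 1) ?p"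
    using assms(7) by (simp add: first_block_sum_one phi_one mult.assoc)
  also have "\<dots> = lin_ext (\<lambda>w. first_block_sum \<phi> (v @ w) (prod_list r)) ?p +
      lin_ext (\<lambda>w. ?\<beta> (v @ w @ r)) ?p"
    unfolding first_block_sum_append[of _ _ r]
    by (simp add: lin_ext_fun_add lin_ext_fun_sum tail[simplified])
  also have "lin_ext (\<lambda>w. first_block_sum \<phi> (v @ w) (prod_list r)) ?p =
      first_block_sum \<phi> v (eval_free ?p * prod_list r)"
    using assms(1) by (simp add: splits_after_first_def)
  also have "\<dots> = \<phi> (prod_list v * eval_free ?p * prod_list r)"
    using assms less.prems by (intro first_block_sum_alternating prod_list_in_part) auto
  finally show ?case by simp
qed

text \<open>For a word \<open>u\<close> of \<open>q\<close>, first blocks ending inside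
  \<open>u\<close> contribute cumulants that vanish by the third assumption; for the others
  \<open>u\<close> joins \<open>x\<close> and the splitting at \<open>p\<close> applies.\<close>

lemma splits_after_first_mult:
  assumes "splits_after_first v p" "q \<in> free_subalgebra (part l)"
    and "\<And>r. set r \<subseteq> part l \<Longrightarrow> r \<noteq> [] \<Longrightarrow> lin_ext (\<lambda>w. boolean_cumulant \<phi> (v @ w @ r)) p = 0"
  shows "splits_after_first v (p * q)"
  unfolding splits_after_first_def
proof
  fix x
  let ?T = "first_block_sum \<phi>"
  have inner: "lin_ext (\<lambda>w. ?T (v @ w @ u) x) p = ?T v (eval_free p * (prod_list u * x))"
    if "set u \<subseteq> part l" for u
  proof -
    have "lin_ext (\<lambda>w. boolean_cumulant \<phi> (v @ w @ take k u)) p = 0" if "k \<in> {1..length u}" for k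
      using that \<open>set u \<subseteq> part l\<close> by (intro assms(3)) (auto dest: in_set_takeD)
    then have "(\<Sum>k=1..length u. lin_ext (\<lambda>w. boolean_cumulant \<phi> (v @ w @ take k u) *
        \<phi> (prod_list (drop k u) * x)) p) = 0"
      by (intro sum.neutral) (simp add: lin_ext_mult_right)
    moreover have "lin_ext (\<lambda>w. ?T ((v @ w) @ u) x) p = lin_ext (\<lambda>w. ?T (v @ w) (prod_list u * x)) p +
        (\<Sum>k=1..length u. lin_ext (\<lambda>w. boolean_cumulant \<phi> (v @ w @ take k u) *
        \<phi> (prod_list (drop k u) * x)) p)"
      unfolding first_block_sum_append[of _ _ u] by (simp add: lin_ext_fun_add lin_ext_fun_sum)
    ultimately show ?thesis
      using assms(1) by (simp add: splits_after_first_def)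
  qed
  have "lin_ext (\<lambda>w. ?T (v @ w) x) (p * q) = lin_ext (\<lambda>u. lin_ext (\<lambda>w. ?T (v @ w @ u) x) p) q"
    unfolding lin_ext_mult by (rule lin_ext_swap)
  also have "\<dots> = lin_ext (\<lambda>u. ?T v (eval_free p * (prod_list u * x))) q"
    using assms(2) by (intro lin_ext_cong_keys inner) (auto simp: free_subalgebra_def)
  also have "\<dots> = lin_ext (\<lambda>w. lin_ext (\<lambda>u. ?T v (prod_list (w @ u) * x)) q) p"
    by (subst lin_ext_swap)
       (simp add: mult.assoc flip: lin_ext_linear[OF linear_first_block_sum, of _ "_ * x"])
  also have "\<dots> = lin_ext (\<lambda>w. ?T v (prod_list w * x)) (p * q)"
    unfolding lin_ext_mult ..
  also have "\<dots> = ?T v (eval_free (p * q) * x)"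
    by (rule lin_ext_linear[OF linear_first_block_sum])
  finally show "lin_ext (\<lambda>w. ?T (v @ w) x) (p * q) = ?T v (eval_free (p * q) * x)" .
qed

text \<open>Factors are appended on the right. The index of the new factor differs from the one
  before it, so \<open>boolean_cumulant_vanishes_step\<close> applies to the shorter product, with
  \<open>r\<close> taken from the new factor.\<close>

lemma splits_after_first_alternating:
  assumes "free_alternating ps" "i \<in> {1, 2}" "distinct_adj (i # map fst ps)"
    and "set v \<subseteq> part i" "v \<noteq> []"
  shows "splits_after_first v (prod_list (map snd ps))"
  using assms(1,3)
proof (induction ps rule: rev_induct)
  case Nil
  then show ?case
    by (simp add: splits_after_first_def lin_ext_one eval_free_one)
next
  case (snoc lq ps)
  obtain l q where lq: "lq = (l, q)" by fastforce
  have q: "l \<in> {1, 2}" "q \<in> free_subalgebra (part l)" and ps: "free_alternating ps"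
    using snoc.prems(1)
    by (auto simp: lq alternating_list_def part_def distinct_adj_append_iff split: if_splits)
  have adj: "distinct_adj (i # map fst ps @ [l])" "distinct_adj (i # map fst ps)"
    using snoc.prems(2) distinct_adj_appendD1[of "i # map fst ps" "[l]"] by (auto simp: lq)
  have IH: "splits_after_first v (prod_list (map snd ps))"
    by (rule snoc.IH[OF ps adj(2)])
  have "splits_after_first v (prod_list (map snd ps) * q)"
    by (rule splits_after_first_mult[OF IH q(2)])
       (rule boolean_cumulant_vanishes_step[OF IH ps assms(2) q(1) adj(1) assms(4,5)])
  then show ?case
    by (simp add: lq)
qed

text \<open>Later used with \<open>i = l\<close>, where \<open>v\<close> and \<open>r\<close> are
  cut from one word; alternation then forces at least one factor between them.\<close>

lemma boolean_cumulant_vanishes: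
  assumes "free_alternating ps" "i \<in> {1, 2}" "l \<in> {1, 2}" "distinct_adj (i # map fst ps @ [l])"
    and "set v \<subseteq> part i" "v \<noteq> []" "set r \<subseteq> part l" "r \<noteq> []"
  shows "lin_ext (\<lambda>w. boolean_cumulant \<phi> (v @ w @ r)) (prod_list (map snd ps)) = 0"
proof -
  have "distinct_adj (i # map fst ps)"
    using assms(4) distinct_adj_appendD1[of "i # map fst ps" "[l]"] by simp
  then have "splits_after_first v (prod_list (map snd ps))"
    using assms by (intro splits_after_first_alternating)
  then show ?thesis
    by (rule boolean_cumulant_vanishes_step[OF _ assms])
qed

section \<open>Cyclic freeness\<close>

lemma cyclic_pairing_vanishes:
  assumes "free_alternating (X @ (l, p) # Y)"
    and "last (map fst (X @ (l, p) # Y)) \<noteq> hd (map fst (X @ (l, p) # Y))"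
  shows "cyclic_pairing \<phi> p (prod_list (map snd (Y @ X))) = 0"
proof -
  let ?q = "prod_list (map snd (Y @ X))"
  have adj: "distinct_adj (l # map fst (Y @ X) @ [l])"
    using distinct_adj_rotate_around[of "map fst X" l "map fst Y"] assms
    by (simp add: alternating_list_def)
  then have alt: "free_alternating (Y @ X)"
    using assms(1) distinct_adj_appendD1[of "map fst (Y @ X)" "[l]"]
    by (auto simp: alternating_list_def dest: distinct_adj_ConsD)
  have l: "l \<in> {1, 2}" "p \<in> free_subalgebra (part l)"
    using assms(1) by (auto simp: alternating_list_def part_def split: if_splits)
  have "lin_ext (cyclic_cut \<phi> (letters w)) ?q = 0" if "w \<in> Poly_Mapping.keys p" for w
  proof -
    have "set (letters w) \<subseteq> part l"
      using l(2) that by (auto simp: free_subalgebra_def)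
    \<comment> \<open>The letter \<open>letters w ! i\<close> occurs in both outer words, which are
      therefore nonempty, also for \<open>i = 0\<close>.\<close>
    then have "lin_ext (\<lambda>v. boolean_cumulant \<phi>
        (drop i (letters w) @ v @ (take i (letters w) @ [letters w ! i]))) ?q = 0"
      if "i < length (letters w)" for i
      using that by (intro boolean_cumulant_vanishes[OF alt l(1) l(1) adj])
        (auto dest: in_set_takeD in_set_dropD)
    then show ?thesis
      unfolding cyclic_cut_def lin_ext_fun_sum by (intro sum.neutral) simp
  qed
  then show ?thesis
    by (simp add: cyclic_pairing_def lin_ext_def[of _ p])
qed

lemma cyclic_pairing_alternating:
  assumes "free_alternating ps" "last (map fst ps) \<noteq> hd (map fst ps)"
  shows "cyclic_pairing \<phi> (prod_list (map snd ps)) 1 = 0"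
proof -
  have "cyclic_pairing \<phi> p (prod_list Y * prod_list X) = 0"
    if split: "map snd ps = X @ p # Y" for X p Y
  proof -
    obtain X' l Y' where "ps = X' @ (l, p) # Y'" "X = map snd X'" "Y = map snd Y'"
      using split by (auto simp: map_eq_append_conv map_eq_Cons_conv)
    then show ?thesis
      using cyclic_pairing_vanishes[of X' l p Y'] assms by simp
  qed
  then show ?thesis
    using cyclic_pairing_prod_list[of "map snd ps" \<phi> "map snd ps" "[]"] by simp
qed

text \<open>Evaluation keeps factors alternating and centred, which gives freeness;
  \<open>j n \<noteq> j 1\<close> makes the sequence alternate cyclically, as the pairing argument
  needs.\<close>

lemma cyclically_free_W_functional:
  "cyclically_free (extend_functional \<psi>) (W_functional \<phi>) (free_subalgebra A1) (free_subalgebra A2)"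
  unfolding cyclically_free_def free_wrt_def
proof (intro conjI allI impI)
  fix n :: nat and j :: "nat \<Rightarrow> nat" and b :: "nat \<Rightarrow> 'a free_algebra"
  assume "1 \<le> n"
    and "alternating_centred (extend_functional \<psi>) (free_subalgebra A1) (free_subalgebra A2) n j b"
  then show "extend_functional \<psi> (oprod n b) = 0"
    using conditionally_free_list(1)[OF cfree alternating_eval_free, of "map (\<lambda>k. (j k, b k)) [1..<n + 1]"]
    by (simp add: alternating_centred_iff_list extend_psi oprod_def eval_free_prod_list o_def
        del: upt_Suc)
next
  fix n :: nat and j :: "nat \<Rightarrow> nat" and b :: "nat \<Rightarrow> 'a free_algebra"
  let ?ps = "map (\<lambda>k. (j k, b k)) [1..<n + 1]"
  assume n: "2 \<le> n"
    and "alternating_centred (extend_functional \<psi>) (free_subalgebra A1) (free_subalgebra A2) n j b \<and>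
      j n \<noteq> j 1"
  then have ps: "free_alternating ?ps" and j: "j n \<noteq> j 1"
    by (auto simp only: alternating_centred_iff_list)
  have "map fst ?ps = map j [1..<n + 1]"
    by (simp add: o_def del: upt_Suc)
  moreover have "hd (map j [1..<n + 1]) = j 1" "last (map j [1..<n + 1]) = j n"
    using n by (simp_all add: hd_map last_map del: upt_Suc)
  ultimately have ends: "last (map fst ?ps) \<noteq> hd (map fst ?ps)"
    using j by (simp del: upt_Suc map_map)
  have "cyclic_pairing \<phi> (prod_list (map snd ?ps)) 1 = 0"
    by (rule cyclic_pairing_alternating[OF ps ends])
  then show "W_functional \<phi> (oprod n b) = 0"
    by (simp only: W_functional_eq_cyclic_pairing oprod_eq_prod_list[of n b j])
qed

end

theorem theorem2p13:
  fixes scale :: "complex \<Rightarrow> 'a::ring_1 \<Rightarrow> 'a"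
    and \<psi> \<phi> :: "'a \<Rightarrow> complex"
    and A1 A2 :: "'a set"
  assumes "complex_algebra scale"
    and "unital_functional scale \<psi>"
    and "unital_functional scale \<phi>"
    and "unital_subalgebra scale A1"
    and "unital_subalgebra scale A2"
    and "conditionally_free \<psi> \<phi> A1 A2"
  shows "unital_functional free_scale (extend_functional \<psi>) \<and>
         tracial_functional free_scale (W_functional \<phi>) \<and>
         unital_subalgebra free_scale (free_subalgebra A1) \<and>
         unital_subalgebra free_scale (free_subalgebra A2) \<and>
         cyclically_free (extend_functional \<psi>) (W_functional \<phi>)
           (free_subalgebra A1) (free_subalgebra A2)"
proof -
  interpret conditionally_free_pair scale \<psi> \<phi> A1 A2
    using assms by (simp add: conditionally_free_pair_def conditionally_free_pair_axioms_def)
  have "unital_functional free_scale (extend_functional \<psi>)"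
    by (simp add: unital_functional_def linear_functional_def extend_functional_def
        linear_lin_ext lin_ext_one psi_one)
  then show ?thesis
    by (simp add: tracial_W_functional unital_subalgebra_free_subalgebra cyclically_free_W_functional)
qed

end
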